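(* For any $k\in\mathbb{N}$, every bipartite graph $G$ with pathwidth at most $k$ has a 2-layer drawing with no $(k+2)$-crossing and no $(k+1,k+1)$-crossing.
   Context: $\mathbb{N}=\{1,2,3,\dots\}$ denotes the positive integers. Graphs are finite and simple. A 2-layer drawing of a bipartite graph $G$ with bipartition $\{A,B\}$ positions the vertices in $A$ at distinct points on a horizontal line, positions the vertices in $B$ at distinct points on a different horizontal line, and draws each edge as a straight line-segment. Equivalently, it is given by total orders $\preceq_A$ on $A$ and $\preceq_B$ on $B$ (left-to-right orders); two edges $vw$ and $xy$ with $v,x\in A$ and $w,y\in B$ cross if and only if ($v\prec_A x$ and $y\prec_B w$) or ($x\prec_A v$ and $w\prec_B y$). In particular, edges sharing an end-vertex do not cross. A matching in a graph is a set of edges, no two of which are incident to a common vertex; a $k$-matching is a matching of size $k$. In a 2-layer drawing, a $k$-crossing is a set of $k$ pairwise crossing edges (necessarily a $k$-matching). A set of edges in a 2-layer drawing is non-crossing if no two edges in it cross. In a 2-layer drawing, an $(s,t)$-crossing is a pair $(S,T)$ where $S$ is a non-crossing $s$-matching, $T$ is a non-crossing $t$-matching, and every edge in $S$ crosses every edge in $T$. A path-decomposition of a graph $G$ is a sequence $(B_1,\dots,B_n)$ of subsets of $V(G)$ (called bags) such that $B_1\cup\dots\cup B_n=V(G)$, both end-vertices of each edge of $G$ lie in a common bag, and $B_i\cap B_k\subseteq B_j$ whenever $1\leq i<j<k\leq n$. Its width is $\max_i|B_i|-1$. The pathwidth of $G$ is the minimum width of a path-decomposition of $G$. *)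

theory Defs
  imports Main
begin

definition finite_simple_graph :: "'a set \<Rightarrow> 'a set set \<Rightarrow> bool" where
  "finite_simple_graph V E \<longleftrightarrow> finite V \<and> (\<forall>e\<in>E. e \<subseteq> V \<and> card e = 2)"

definition bipartition :: "'a set \<Rightarrow> 'a set set \<Rightarrow> 'a set \<Rightarrow> 'a set \<Rightarrow> bool" where
  "bipartition V E A B \<longleftrightarrow> A \<union> B = V \<and> A \<inter> B = {} \<and> (\<forall>e\<in>E. \<exists>v\<in>A. \<exists>w\<in>B. e = {v, w})"

text \<open>Bags are indexed from 0. The list of bags is required to be nonempty, since the width is a
  maximum over the bags; this loses no path-decomposition of a graph with at least one vertex.\<close>

definition path_decomposition :: "'a set \<Rightarrow> 'a set set \<Rightarrow> 'a set list \<Rightarrow> bool" where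
  "path_decomposition V E Bs \<longleftrightarrow>
     Bs \<noteq> [] \<and> \<Union>(set Bs) = V \<and> (\<forall>e\<in>E. \<exists>X\<in>set Bs. e \<subseteq> X) \<and>
     (\<forall>i j l. i < j \<and> j < l \<and> l < length Bs \<longrightarrow> Bs ! i \<inter> Bs ! l \<subseteq> Bs ! j)"

text \<open>Widths are integers, so that the graph without vertices has pathwidth $-1$.\<close>

definition decomposition_width :: "'a set list \<Rightarrow> int" where
  "decomposition_width Bs = int (Max (card ` set Bs)) - 1"

definition pathwidth :: "'a set \<Rightarrow> 'a set set \<Rightarrow> int" where
  "pathwidth V E = Min {decomposition_width Bs | Bs. path_decomposition V E Bs}"

text \<open>For a finite simple graph the minimum is taken over a finite nonempty set, hence attained.\<close>

lemma finite_decomposition_widths: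
  assumes "finite V"
  shows "finite {decomposition_width Bs | Bs. path_decomposition V E Bs}"
proof (rule finite_subset)
  show "{decomposition_width Bs | Bs. path_decomposition V E Bs} \<subseteq> {-1 .. int (card V)}"
  proof clarsimp
    fix Bs assume Bs: "path_decomposition V E Bs"
    have "Max (card ` set Bs) \<le> card V"
      using Bs assms by (subst Max_le_iff) (auto simp: path_decomposition_def intro!: card_mono)
    then show "- 1 \<le> decomposition_width Bs \<and> decomposition_width Bs \<le> int (card V)"
      by (simp add: decomposition_width_def)
  qed
qed simp

lemma path_decomposition_trivial:
  assumes "finite_simple_graph V E"
  shows "path_decomposition V E [V]"
  using assms by (auto simp: path_decomposition_def finite_simple_graph_def)

lemma pathwidth_le_iff:
  assumes "finite_simple_graph V E"
  shows "pathwidth V E \<le> w \<longleftrightarrow> (\<exists>Bs. path_decomposition V E Bs \<and> decomposition_width Bs \<le> w)"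
proof -
  have "finite V" using assms by (simp add: finite_simple_graph_def)
  then show ?thesis
    unfolding pathwidth_def using path_decomposition_trivial[OF assms]
    by (subst Min_le_iff) (auto intro: finite_decomposition_widths)
qed

text \<open>A 2-layer drawing is represented by the left-to-right orders of the two parts.\<close>

definition two_layer_drawing :: "'a set \<Rightarrow> 'a set \<Rightarrow> 'a rel \<Rightarrow> 'a rel \<Rightarrow> bool" where
  "two_layer_drawing A B rA rB \<longleftrightarrow> linear_order_on A rA \<and> linear_order_on B rB"

definition strictly_left :: "'a rel \<Rightarrow> 'a \<Rightarrow> 'a \<Rightarrow> bool" where
  "strictly_left r x y \<longleftrightarrow> (x, y) \<in> r \<and> x \<noteq> y"

definition cross ::
    "'a set \<Rightarrow> 'a set \<Rightarrow> 'a rel \<Rightarrow> 'a rel \<Rightarrow> 'a set \<Rightarrow> 'a set \<Rightarrow> bool" where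
  "cross A B rA rB e f \<longleftrightarrow>
     (\<exists>v\<in>A. \<exists>w\<in>B. \<exists>x\<in>A. \<exists>y\<in>B. e = {v, w} \<and> f = {x, y} \<and>
        (strictly_left rA v x \<and> strictly_left rB y w \<or>
         strictly_left rA x v \<and> strictly_left rB w y))"

definition matching :: "'a set set \<Rightarrow> nat \<Rightarrow> 'a set set \<Rightarrow> bool" where
  "matching E k M \<longleftrightarrow> M \<subseteq> E \<and> card M = k \<and> (\<forall>e\<in>M. \<forall>f\<in>M. e \<noteq> f \<longrightarrow> e \<inter> f = {})"

definition non_crossing ::
    "'a set \<Rightarrow> 'a set \<Rightarrow> 'a rel \<Rightarrow> 'a rel \<Rightarrow> 'a set set \<Rightarrow> bool" where
  "non_crossing A B rA rB F \<longleftrightarrow> (\<forall>e\<in>F. \<forall>f\<in>F. \<not> cross A B rA rB e f)"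

definition k_crossing ::
    "'a set set \<Rightarrow> 'a set \<Rightarrow> 'a set \<Rightarrow> 'a rel \<Rightarrow> 'a rel \<Rightarrow> nat \<Rightarrow> 'a set set \<Rightarrow> bool" where
  "k_crossing E A B rA rB k F \<longleftrightarrow>
     F \<subseteq> E \<and> card F = k \<and> (\<forall>e\<in>F. \<forall>f\<in>F. e \<noteq> f \<longrightarrow> cross A B rA rB e f)"

definition st_crossing ::
    "'a set set \<Rightarrow> 'a set \<Rightarrow> 'a set \<Rightarrow> 'a rel \<Rightarrow> 'a rel \<Rightarrow> nat \<Rightarrow> nat \<Rightarrow>
     'a set set \<Rightarrow> 'a set set \<Rightarrow> bool" where
  "st_crossing E A B rA rB s t S T \<longleftrightarrow>
     matching E s S \<and> non_crossing A B rA rB S \<and>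
     matching E t T \<and> non_crossing A B rA rB T \<and>
     (\<forall>e\<in>S. \<forall>f\<in>T. cross A B rA rB e f)"

end

theory Submission
  imports Defs
begin

text \<open>Draw both layers ordered by the index at which a vertex first appears in an optimal
  path-decomposition, and say that an edge starts at the index where the later of its two ends
  first appears. Suppose that \<open>e\<close> crosses every edge of a matching \<open>M\<close> and starts no later than any
  edge of \<open>M\<close>, say at \<open>p\<close>. By the crossing condition each edge of \<open>M\<close> has an end first appearing
  no later than \<open>p\<close>, and this end remains until that edge starts, so it lies in bag \<open>p\<close>. Together
  with the two ends of \<open>e\<close> this gives \<open>|M| + 2\<close> vertices in one bag. For a \<open>(k+2)\<close>-crossing let
  \<open>e\<close> be its earliest edge and \<open>M\<close> the rest; for a \<open>(k+1,k+1)\<close>-crossing let \<open>e\<close> be the earliest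
  edge of \<open>S \<union> T\<close> and \<open>M\<close> the side not containing \<open>e\<close>.\<close>

definition first_bag :: "'a set list \<Rightarrow> 'a \<Rightarrow> nat" where
  "first_bag Bs v = (LEAST i. i < length Bs \<and> v \<in> Bs ! i)"

definition edge_start :: "'a set list \<Rightarrow> 'a set \<Rightarrow> nat" where
  "edge_start Bs e = Max (first_bag Bs ` e)"

lemma first_bag:
  assumes "i < length Bs" "v \<in> Bs ! i"
  shows "first_bag Bs v \<le> i" "v \<in> Bs ! first_bag Bs v"
proof -
  show "first_bag Bs v \<le> i"
    unfolding first_bag_def using assms by (intro Least_le) simp
  show "v \<in> Bs ! first_bag Bs v"
    unfolding first_bag_def
    by (rule LeastI2[of "\<lambda>i. i < length Bs \<and> v \<in> Bs ! i" i]) (use assms in auto)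
qed

text \<open>Some bag \<open>m\<close> contains all of \<open>f\<close>, hence
  \<open>edge_start Bs f \<le> m\<close>. So \<open>p\<close> lies between the first bag of
  \<open>u\<close> and \<open>m\<close>, both of which contain \<open>u\<close>, and the bags
  containing a vertex form an interval.\<close>

lemma edge_start_in_bag:
  assumes pd: "path_decomposition V E Bs" and "f \<in> E" "finite f" "u \<in> f"
    and "first_bag Bs u \<le> p" "p \<le> edge_start Bs f"
  shows "p < length Bs" "u \<in> Bs ! p"
proof -
  obtain m where m: "m < length Bs" "f \<subseteq> Bs ! m"
    using pd \<open>f \<in> E\<close> unfolding path_decomposition_def by (metis in_set_conv_nth)
  have "first_bag Bs v \<le> m" if "v \<in> f" for v
    using first_bag(1)[OF m(1)] m(2) that by blast
  then have "edge_start Bs f \<le> m"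
    unfolding edge_start_def using assms(3,4) by (subst Max_le_iff) auto
  then have pm: "p \<le> m" using assms(6) by simp
  then show "p < length Bs" using m by simp
  have um: "u \<in> Bs ! m" using m assms(4) by blast
  then have ul: "u \<in> Bs ! first_bag Bs u" using first_bag(2) m(1) by metis
  \<comment> \<open>The interval property is stated for strictly increasing indices only, so the two
    boundary cases are split off.\<close>
  consider "first_bag Bs u = p" | "p = m" | "first_bag Bs u < p" "p < m"
    using pm assms(5) by linarith
  then show "u \<in> Bs ! p"
  proof cases
    case 3
    then have "Bs ! first_bag Bs u \<inter> Bs ! m \<subseteq> Bs ! p"
      using pd m(1) unfolding path_decomposition_def by blast
    then show ?thesis using um ul by blast
  qed (use um ul in auto)
qed

text \<open>Order lexicographically by \<open>l\<close> and then by an injective numbering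
  \<open>g\<close> of \<open>A\<close>, which breaks the ties between vertices that first appear in
  the same bag.\<close>

lemma ex_linear_order_on_refining:
  fixes l :: "'a \<Rightarrow> 'b::linorder"
  assumes "finite A"
  shows "\<exists>r. linear_order_on A r \<and> (\<forall>x y. (x, y) \<in> r \<longrightarrow> l x \<le> l y)"
proof -
  obtain g :: "'a \<Rightarrow> nat" where g: "inj_on g A"
    using finite_imp_inj_to_nat_seg[OF assms] by blast
  define r where "r = {(x, y). x \<in> A \<and> y \<in> A \<and> (l x < l y \<or> l x = l y \<and> g x \<le> g y)}"
  have "linear_order_on A r"
    unfolding linear_order_on_def partial_order_on_def preorder_on_def
    using g by (auto simp: r_def refl_on_def trans_def antisym_def total_on_def inj_on_def)
  then show ?thesis by (intro exI[of _ r]) (auto simp: r_def)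
qed

text \<open>Crossing separates the two ends in \<open>A\<close> as well as the two ends in
  \<open>B\<close>, and an end in \<open>A\<close> never equals one in \<open>B\<close>.\<close>

lemma cross_disjoint:
  assumes "A \<inter> B = {}" "cross A B rA rB e f"
  shows "e \<inter> f = {}"
proof -
  obtain v w x y where "v \<in> A" "w \<in> B" "x \<in> A" "y \<in> B" "e = {v, w}" "f = {x, y}"
      "v \<noteq> x" "w \<noteq> y"
    using assms(2) unfolding cross_def strictly_left_def by blast
  with assms(1) show ?thesis by auto
qed

lemma cross_sym: "cross A B rA rB e f \<Longrightarrow> cross A B rA rB f e"
  unfolding cross_def by blast

text \<open>On one of the two layers the end of \<open>f\<close> is to the left of the end of
  \<open>e\<close>, so it first appears no later than that end.\<close>

lemma cross_ex_early_vertex: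
  assumes "\<And>x y. (x, y) \<in> rA \<Longrightarrow> first_bag Bs x \<le> first_bag Bs y"
    and "\<And>x y. (x, y) \<in> rB \<Longrightarrow> first_bag Bs x \<le> first_bag Bs y"
    and "cross A B rA rB e f"
  shows "\<exists>u\<in>f. first_bag Bs u \<le> edge_start Bs e"
proof -
  obtain v w x y where *: "e = {v, w}" "f = {x, y}" "(y, w) \<in> rB \<or> (x, v) \<in> rA"
    using assms(3) unfolding cross_def strictly_left_def by blast
  have "first_bag Bs y \<le> first_bag Bs w \<or> first_bag Bs x \<le> first_bag Bs v"
    using * assms(1,2) by blast
  then show ?thesis using * by (auto simp: edge_start_def le_max_iff_disj)
qed

text \<open>The drawing enters only through \<open>dise\<close> and \<open>early\<close>, so both
  kinds of crossing can be treated at once. The large bag is the one at index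
  \<open>edge_start Bs e\<close>.\<close>

lemma earliest_edge_large_bag:
  assumes pd: "path_decomposition V E Bs" and gr: "finite_simple_graph V E"
    and "e \<in> E" "M \<subseteq> E" "finite M"
    and disj: "\<And>f g. f \<in> M \<Longrightarrow> g \<in> M \<Longrightarrow> f \<noteq> g \<Longrightarrow> f \<inter> g = {}"
    and dise: "\<And>f. f \<in> M \<Longrightarrow> e \<inter> f = {}"
    and early: "\<And>f. f \<in> M \<Longrightarrow> \<exists>u\<in>f. first_bag Bs u \<le> edge_start Bs e"
    and least: "\<And>f. f \<in> M \<Longrightarrow> edge_start Bs e \<le> edge_start Bs f"
  shows "\<exists>X\<in>set Bs. card M + 2 \<le> card X"
proof -
  define p where "p = edge_start Bs e"
  have fin: "finite f" "card f = 2" if "f \<in> E" for f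
    using gr that unfolding finite_simple_graph_def by (auto intro: finite_subset)
  have first_le: "first_bag Bs u \<le> p" if "u \<in> e" for u
    unfolding p_def edge_start_def using that fin \<open>e \<in> E\<close> by auto
  \<comment> \<open>Here \<open>e\<close> itself plays the role of \<open>f\<close>, with
    \<open>p\<close> equal to its own start.\<close>
  have e_sub: "e \<subseteq> Bs ! p"
    using edge_start_in_bag(2)[OF pd \<open>e \<in> E\<close> fin(1)[OF \<open>e \<in> E\<close>]] first_le p_def by blast
  obtain u0 where "u0 \<in> e" using fin(2)[OF \<open>e \<in> E\<close>] by fastforce
  then have pl: "p < length Bs"
    using edge_start_in_bag(1)[OF pd \<open>e \<in> E\<close> fin(1)[OF \<open>e \<in> E\<close>]] first_le p_def by blast
  obtain u where u: "\<And>f. f \<in> M \<Longrightarrow> u f \<in> f \<and> first_bag Bs (u f) \<le> p"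
    using early unfolding p_def by metis
  have M_sub: "u ` M \<subseteq> Bs ! p"
  proof
    fix x assume "x \<in> u ` M"
    then obtain f where f: "f \<in> M" "x = u f" by blast
    then show "x \<in> Bs ! p"
      using edge_start_in_bag(2)[OF pd _ fin(1), of f] u[OF f(1)] least[OF f(1)] \<open>M \<subseteq> E\<close> p_def
      by blast
  qed
  \<comment> \<open>A vertex chosen for two different edges of \<open>M\<close> would lie in both,
    but these are disjoint.\<close>
  have "inj_on u M" using u disj unfolding inj_on_def by fastforce
  then have cardM: "card (u ` M) = card M" by (rule card_image)
  have "card (e \<union> u ` M) = card e + card (u ` M)"
    using fin(1)[OF \<open>e \<in> E\<close>] \<open>finite M\<close> u dise by (intro card_Un_disjoint) blast+
  then have "card (e \<union> u ` M) = card M + 2" using cardM fin(2)[OF \<open>e \<in> E\<close>] by simp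
  moreover have "finite (Bs ! p)"
    using pd gr pl unfolding path_decomposition_def finite_simple_graph_def
    by (metis Sup_upper finite_subset nth_mem)
  then have "card (e \<union> u ` M) \<le> card (Bs ! p)"
    using e_sub M_sub by (intro card_mono) auto
  ultimately show ?thesis using pl by (metis nth_mem)
qed

theorem theorem3:
  fixes V A B :: "'a set" and E :: "'a set set" and k :: nat
  assumes "k \<ge> 1"
    and "finite_simple_graph V E"
    and "bipartition V E A B"
    and "pathwidth V E \<le> int k"
  shows "\<exists>rA rB. two_layer_drawing A B rA rB \<and>
           (\<nexists>F. k_crossing E A B rA rB (k + 2) F) \<and>
           (\<nexists>S T. st_crossing E A B rA rB (k + 1) (k + 1) S T)"
proof -
  obtain Bs where pd: "path_decomposition V E Bs" and width: "decomposition_width Bs \<le> int k"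
    using assms(2,4) by (auto simp: pathwidth_le_iff)
  have card_bag: "card X \<le> k + 1" if "X \<in> set Bs" for X
  proof -
    have "card X \<le> Max (card ` set Bs)" using that by simp
    then show ?thesis using width unfolding decomposition_width_def by linarith
  qed
  have AB: "A \<inter> B = {}" and "finite A" "finite B"
    using assms(2,3) unfolding bipartition_def finite_simple_graph_def by auto
  obtain rA where rA: "linear_order_on A rA"
      "\<And>x y. (x, y) \<in> rA \<Longrightarrow> first_bag Bs x \<le> first_bag Bs y"
    using ex_linear_order_on_refining[OF \<open>finite A\<close>] by metis
  obtain rB where rB: "linear_order_on B rB"
      "\<And>x y. (x, y) \<in> rB \<Longrightarrow> first_bag Bs x \<le> first_bag Bs y"
    using ex_linear_order_on_refining[OF \<open>finite B\<close>] by metis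
  \<comment> \<open>The bound comes from \<open>card M + 2 \<le> card X \<le> k + 1\<close>.\<close>
  have matching_small: "card M < k" if "e \<in> E" "M \<subseteq> E" "finite M"
      and disj: "\<And>f g. f \<in> M \<Longrightarrow> g \<in> M \<Longrightarrow> f \<noteq> g \<Longrightarrow> f \<inter> g = {}"
      and cr: "\<And>f. f \<in> M \<Longrightarrow> cross A B rA rB e f"
      and least: "\<And>f. f \<in> M \<Longrightarrow> edge_start Bs e \<le> edge_start Bs f" for e M
  proof -
    have "\<exists>X\<in>set Bs. card M + 2 \<le> card X"
      by (rule earliest_edge_large_bag[OF pd assms(2) that(1-3) disj
            cross_disjoint[OF AB cr] cross_ex_early_vertex[OF rA(2) rB(2) cr] least])
    then obtain X where "X \<in> set Bs" "card M + 2 \<le> card X" by blast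
    with card_bag[of X] show ?thesis by simp
  qed
  have "\<not> k_crossing E A B rA rB (k + 2) F" for F
  proof
    assume F: "k_crossing E A B rA rB (k + 2) F"
    then have sub: "F \<subseteq> E" and card: "card F = k + 2"
      and cr: "\<And>e f. e \<in> F \<Longrightarrow> f \<in> F \<Longrightarrow> e \<noteq> f \<Longrightarrow> cross A B rA rB e f"
      unfolding k_crossing_def by auto
    have finF: "finite F" using card by (intro card_ge_0_finite) simp
    have "F \<noteq> {}" using card by auto
    then obtain e where e: "e \<in> F" "\<And>f. f \<in> F \<Longrightarrow> edge_start Bs e \<le> edge_start Bs f"
      using finF by (metis (no_types, lifting)
          arg_min_if_finite(1) arg_min_least)
    \<comment> \<open>Pairwise crossing edges are disjoint, so \<open>F - {e}\<close> is a matching;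
      it has \<open>k + 1\<close> edges.\<close>
    have "card (F - {e}) < k"
      using e sub finF cr cross_disjoint[OF AB cr] by (intro matching_small[of e]) auto
    then show False using e(1) finF card by simp
  qed
  moreover have "\<not> st_crossing E A B rA rB (k + 1) (k + 1) S T" for S T
  proof
    assume "st_crossing E A B rA rB (k + 1) (k + 1) S T"
    then have S: "matching E (k + 1) S" and T: "matching E (k + 1) T"
      and cr: "\<And>e f. e \<in> S \<Longrightarrow> f \<in> T \<Longrightarrow> cross A B rA rB e f"
      unfolding st_crossing_def by auto
    have fin: "finite S" "finite T"
      using S T by (auto simp: matching_def intro!: card_ge_0_finite)
    have "S \<union> T \<noteq> {}" using S by (auto simp: matching_def)
    then obtain e where e: "e \<in> S \<union> T"
        "\<And>f. f \<in> S \<union> T \<Longrightarrow> edge_start Bs e \<le> edge_start Bs f"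
      using fin by (metis (no_types, lifting) arg_min_if_finite(1) arg_min_least finite_UnI)
    from e(1) consider "e \<in> S" | "e \<in> T" by blast
    then show False
    proof cases
      case 1
      have "card T < k"
        using 1 e S T fin cr by (intro matching_small[of e]) (auto simp: matching_def)
      then show False using T by (simp add: matching_def)
    next
      case 2
      \<comment> \<open>Now \<open>e\<close> lies in \<open>T\<close>, so the crossings with the
        edges of \<open>S\<close> are needed in reversed order.\<close>
      have "card S < k"
        using 2 e S T fin cross_sym[OF cr]
        by (intro matching_small[of e]) (auto simp: matching_def)
      then show False using S by (simp add: matching_def)
    qed
  qed
  ultimately show ?thesis
    using rA(1) rB(1) unfolding two_layer_drawing_def by blast
qed

end
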